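(* Let $q \geq 4$ be a prime power and $n = q^{2}-1$. Then there exists a convolutional code with parameters $(n,\; n-2q+1,\; 2q-3;\; 1,\; d_{free} \geq 2q+1)_{q}$.
   Context: A matrix $G(D)=(g_{ij})\in \mathbb{F}_q[D]^{k\times n}$ is called basic if it has a polynomial right inverse. Its $i$-th row degree is $\gamma_i=\max_{1\le j\le n}\deg g_{ij}$ and its overall constraint length is $\gamma=\sum_{i=1}^k\gamma_i$. A basic generator matrix of a code is called reduced if its overall constraint length is the smallest among all basic generator matrices of that code. A convolutional code with parameters $(n,k,\gamma;\mu,d_f)_q$ is a submodule $C=\{\mathbf{u}(D)G(D) : \mathbf{u}(D)\in\mathbb{F}_q[D]^k\}$ of $\mathbb{F}_q[D]^n$ generated by a reduced basic matrix $G(D)\in\mathbb{F}_q[D]^{k\times n}$, where $n$ is the length, $k$ the dimension, $\gamma=\sum_{i=1}^k\gamma_i$ the degree, $\mu=\max_{1\le i\le k}\gamma_i$ the memory, and $d_f=d_{free}=\min\{\mathrm{wt}(\mathbf{v}(D)) : \mathbf{v}(D)\in C,\ \mathbf{v}(D)\neq 0\}$ the free distance; here $\mathrm{wt}(\mathbf{v}(D))$ is the total number of nonzero coefficients over all $n$ polynomial components of $\mathbf{v}(D)$. Writing "$d_{free}\ge a$" in the last slot means the free distance is at least $a$. *)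

theory Defs
  imports
    "HOL-Library.Cardinality"
    "Jordan_Normal_Form.Matrix"
    "HOL-Computational_Algebra.Polynomial"
    "HOL-Number_Theory.Prime_Powers"
begin

definition basic_mat :: "'a::field poly mat \<Rightarrow> bool" where
  "basic_mat G \<longleftrightarrow>
     (\<exists>H \<in> carrier_mat (dim_col G) (dim_row G). G * H = 1\<^sub>m (dim_row G))"

text \<open>Below, rows and columns are indexed from 0. The zero polynomial has degree 0 here instead of
  minus infinity; this is immaterial for basic matrices, which have no zero row. The values for
  matrices without columns (in row_degree) or without rows (in memory) are arbitrary.\<close>

definition row_degree :: "'a::field poly mat \<Rightarrow> nat \<Rightarrow> nat" where
  "row_degree G i = Max ((\<lambda>j. degree (G $$ (i, j))) ` {..<dim_col G})"

definition overall_constraint_length :: "'a::field poly mat \<Rightarrow> nat" where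
  "overall_constraint_length G = (\<Sum>i<dim_row G. row_degree G i)"

definition memory :: "'a::field poly mat \<Rightarrow> nat" where
  "memory G = Max (row_degree G ` {..<dim_row G})"

text \<open>The row vector product u G is the column vector product of the transpose of G with u.\<close>

definition code_of :: "'a::field poly mat \<Rightarrow> 'a poly vec set" where
  "code_of G = {transpose_mat G *\<^sub>v u | u. u \<in> carrier_vec (dim_row G)}"

definition reduced_basic_mat :: "'a::field poly mat \<Rightarrow> bool" where
  "reduced_basic_mat G \<longleftrightarrow>
     basic_mat G \<and>
     (\<forall>G'. basic_mat G' \<and> code_of G' = code_of G \<longrightarrow>
        overall_constraint_length G \<le> overall_constraint_length G')"

definition wt :: "'a::field poly vec \<Rightarrow> nat" where
  "wt v = (\<Sum>j<dim_vec v. card {i. coeff (v $ j) i \<noteq> 0})"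

text \<open>An infimum of natural numbers is a minimum if the set is nonempty, i.e. for a nonzero code.\<close>

definition free_distance :: "'a::field poly vec set \<Rightarrow> nat" where
  "free_distance C = Inf {wt v | v. v \<in> C \<and> v \<noteq> 0\<^sub>v (dim_vec v)}"

definition convolutional_code ::
    "nat \<Rightarrow> nat \<Rightarrow> nat \<Rightarrow> nat \<Rightarrow> nat \<Rightarrow> 'a::field poly vec set \<Rightarrow> bool" where
  "convolutional_code n k \<gamma> \<mu> d C \<longleftrightarrow>
     (\<exists>G \<in> carrier_mat k n. reduced_basic_mat G \<and> C = code_of G \<and>
        \<gamma> = overall_constraint_length G \<and> \<mu> = memory G) \<and>
     d = free_distance C"

end

theory Submission
  imports
    "HOL-Algebra.Algebraic_Closure_Type"
    "HOL-Number_Theory.Residues"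
    "Jordan_Normal_Form.Determinant"
    Defs
begin

text \<open>Index the coordinates by the nonzero elements \<open>x\<close> of the field with \<open>q\<^sup>2\<close> elements. The
  BCH code with zeros \<open>0, \<dots>, 2 q - 1\<close> has the \<open>4 q - 4\<close> independent parity checks
  \<open>x \<mapsto> Tr (\<lambda> x\<^sup>e)\<close>, which split into \<open>2 q - 1\<close> checks \<open>H\<^sub>0\<close> with \<open>0 \<le> e < q\<close> and \<open>2 q - 3\<close> checks
  \<open>H\<^sub>1\<close> with \<open>q < e < 2 q\<close>; the zero \<open>q\<close> is a conjugate of \<open>1\<close>. Complete the checks to a basis and
  let \<open>b\<^sub>r\<close> be the dual basis. The generator matrix has the rows \<open>b\<^sub>r + D b\<^sub>s\<close>, which pair each check
  \<open>r\<close> of \<open>H\<^sub>1\<close> with a check \<open>s\<close> of \<open>H\<^sub>0\<close>, and the constant rows \<open>b\<^sub>r\<close> for \<open>r\<close> outside both.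

  The lowest coefficient of a codeword satisfies \<open>H\<^sub>0\<close> and the highest satisfies \<open>H\<^sub>1\<close>, so if they are
  different coefficients, then the BCH bound gives them weights at least \<open>q + 1\<close> and \<open>q\<close>. If they
  coincide, the coefficient lies in the BCH code, whose minimum distance is at least \<open>2 q + 1\<close>.

  The matrix is reduced because the rows of degree \<open>0\<close> of any basic generator matrix are independent
  constant codewords, and the constant codewords are spanned by the constant rows chosen here.\<close>

subsection \<open>Roots of unity and Frobenius in the algebraic closure\<close>

text \<open>Over an algebraically closed field \<open>X ^ n - 1\<close> splits. A double root would
  also be a root of the derivative \<open>n X ^ (n - 1)\<close>, hence \<open>0\<close>, so all
  roots are simple and their number is the degree.\<close>

lemma card_roots_of_unity_alg_closed:
  fixes n :: nat
  assumes "of_nat n \<noteq> (0 :: 'a :: alg_closed_field)"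
  shows "card {x :: 'a. x ^ n = 1} = n"
proof -
  define p :: "'a poly" where "p = monom 1 n - 1"
  have n0: "n > 0" using assms by (cases n) auto
  have deg: "degree p = n"
  proof (rule antisym)
    show "degree p \<le> n" unfolding p_def
      by (rule degree_diff_le) (auto simp: degree_monom_le)
    show "n \<le> degree p" using n0 by (intro le_degree) (simp add: p_def)
  qed
  have p0: "p \<noteq> 0" using deg n0 by auto
  have roots: "poly p x = 0 \<longleftrightarrow> x ^ n = 1" for x
    by (simp add: p_def poly_monom)
  have order1: "order x p = 1" if x: "poly p x = 0" for x
  proof -
    have "\<not> [:-x, 1:] ^ 2 dvd p"
    proof
      assume "[:-x, 1:] ^ 2 dvd p"
      then obtain r where r: "p = [:-x, 1:] ^ 2 * r" by (elim dvdE)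
      have "poly (pderiv p) x = 0"
        unfolding r power2_eq_square mult.assoc pderiv_mult by (simp add: pderiv_mult del: mult_pCons_left)
      then have "of_nat n * x ^ (n - 1) = 0"
        by (simp add: p_def pderiv_diff pderiv_monom poly_monom)
      then have "x = 0" using assms by auto
      then show False using x n0 by (simp add: roots power_0_left)
    qed
    then have "order x p < 2" using p0 by (metis not_less order_divides)
    moreover have "order x p \<noteq> 0" using x p0 by (simp add: order_root)
    ultimately show ?thesis by linarith
  qed
  obtain A where A: "size A = degree p" "p = smult (lead_coeff p) (\<Prod>x\<in>#A. [:-x, 1:])"
    using alg_closed_imp_factorization[OF p0] by blast
  have "proots (\<Prod>x\<in>#B. [:-x, 1:]) = B" for B :: "'a multiset"
  proof (induction B)
    case (add b B)
    have "(\<Prod>x\<in>#B. [:-x, 1:]) \<noteq> 0" by auto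
    then show ?case using add by (simp add: proots_mult del: mult_pCons_left)
  qed simp
  then have "proots p = A" using A(2) p0
    by (metis proots_smult leading_coeff_0_iff)
  then have "degree p = (\<Sum>x\<in>{x. poly p x = 0}. order x p)"
    using A(1) p0 by (simp add: size_multiset_overloaded_eq flip: \<open>proots p = A\<close>)
  also have "\<dots> = card {x. poly p x = 0}" using order1 by simp
  finally show ?thesis by (simp add: deg roots)
qed

lemma CHAR_power_eq_CARD:
  assumes "primepow CARD('a :: {field, finite})"
  obtains k where "CARD('a) = CHAR('a) ^ k" "prime CHAR('a)"
proof -
  have pr: "prime CHAR('a)"
    using prime_CHAR_semidom[where ?'a = 'a] finite_imp_CHAR_pos[where ?'a = 'a] by auto
  obtain p k where pk: "prime p" "CARD('a) = p ^ k" using assms by (auto simp: primepow_def)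
  have "CHAR('a) dvd p ^ k" using CHAR_dvd_CARD[where ?'a = 'a] pk by simp
  then have "CHAR('a) = p" using pr pk(1) prime_dvd_power primes_dvd_imp_eq by blast
  with pk pr that show ?thesis by blast
qed

lemma finite_field_power_CARD: "x ^ CARD('a) = (x :: 'a :: {field, finite})"
proof (cases "x = 0")
  case False
  have "x ^ (CARD('a) - 1) * \<Prod>(UNIV - {0}) = (\<Prod>y\<in>UNIV - {0}. x * y)"
    by (simp add: prod.distrib)
  also have "\<dots> = \<Prod>(UNIV - {0})"
    by (rule prod.reindex_bij_witness[of _ "\<lambda>y. y / x" "\<lambda>y. x * y"]) (use False in auto)
  finally have "x ^ (CARD('a) - 1) = 1" by simp
  then show ?thesis by (subst power_eq_if) simp
qed (simp add: zero_power)

text \<open>\<open>X ^ q - X\<close> with \<open>q = CARD('a)\<close> has at most \<open>q\<close>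
  roots, and the \<open>q\<close> elements of the base field already are roots.\<close>

lemma range_to_ac_iff:
  "x ^ CARD('a :: {field, finite}) = (x :: 'a alg_closure) \<longleftrightarrow> x \<in> range to_ac"
proof -
  let ?q = "CARD('a)"
  define p :: "'a alg_closure poly" where "p = monom 1 ?q - monom 1 1"
  have q1: "?q > 1" using card_mono[of "UNIV :: 'a set" "{0, 1}"] by simp
  have "poly.coeff p ?q = 1" using q1 by (simp add: p_def)
  then have p0: "p \<noteq> 0" by auto
  have deg: "degree p \<le> ?q" unfolding p_def
    by (rule degree_diff_le) (use q1 in \<open>auto intro: order_trans[OF degree_monom_le]\<close>)
  have "range to_ac \<subseteq> {x. poly p x = 0}"
    by (auto simp: p_def poly_monom finite_field_power_CARD simp flip: to_ac_power)
  moreover have "card {x. poly p x = 0} \<le> card (range (to_ac :: 'a \<Rightarrow> _))"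
    using card_poly_roots_bound[OF p0] deg by (simp add: card_image[OF inj_to_ac])
  ultimately have "range to_ac = {x. poly p x = 0}"
    using poly_roots_finite[OF p0] by (intro card_seteq) auto
  then show ?thesis by (auto simp: p_def poly_monom)
qed

text \<open>The field with \<open>q ^ 2\<close> elements is not a type of its own: its elements are
  the \<open>y\<close> of the closure with \<open>y ^ (q * q) = y\<close>, and \<open>x\<close>
  enumerates the nonzero ones.\<close>

locale quadratic_extension =
  fixes q n :: nat and x :: "nat \<Rightarrow> 'a :: {field, finite} alg_closure"
  assumes CARD_eq: "CARD('a) = q"
    and primepow_q: "primepow q"
    and n_eq: "n = q ^ 2 - 1"
    and x: "bij_betw x {..<n} {y. y ^ n = 1}"
begin

lemma q_gt_1: "q > 1"
  using primepow_q primepow_gt_Suc_0 by auto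

lemma n_pos: "n > 0"
  using q_gt_1 by (simp add: n_eq power2_eq_square one_less_mult)

lemma q_mult_q: "q * q = Suc n"
  using q_gt_1 by (simp add: n_eq power2_eq_square)

lemma frobenius_add: "(y + z) ^ q = y ^ q + (z ^ q :: 'a alg_closure)"
proof -
  obtain k where "CARD('a) = CHAR('a) ^ k" "prime CHAR('a)"
    using CHAR_power_eq_CARD CARD_eq primepow_q by blast
  then show ?thesis by (intro freshmans_dream') (auto simp: CARD_eq)
qed

lemma frobenius_sum: "sum f A ^ q = (\<Sum>i\<in>A. f i ^ q :: 'a alg_closure)"
proof (induction A rule: infinite_finite_induct)
  case (insert a A)
  then show ?case by (simp add: frobenius_add)
qed (use q_gt_1 in auto)

lemma frobenius_to_ac [simp]: "to_ac c ^ q = to_ac (c :: 'a)"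
  by (metis CARD_eq finite_field_power_CARD to_ac_power)

lemma x_power_n [simp]: "j < n \<Longrightarrow> x j ^ n = 1"
  using x by (auto simp: bij_betw_def)

lemma x_nonzero [simp]: "j < n \<Longrightarrow> x j \<noteq> 0"
  by (metis n_pos not_gr_zero power_0_left x_power_n zero_neq_one)

lemma frobenius_x_twice: "j < n \<Longrightarrow> x j ^ (q * q) = x j"
  by (simp add: q_mult_q)

lemma inj_on_x: "inj_on x {..<n}"
  using x by (simp add: bij_betw_def)

lemma poly_eq_0_if_vanishes:
  assumes "degree p < n" "\<And>j. j < n \<Longrightarrow> poly p (x j) = 0"
  shows "p = 0"
  by (rule poly_eqI_degree[of "x ` {..<n}"]) (use assms n_pos in \<open>auto simp: card_image[OF inj_on_x]\<close>)

text \<open>Trace to the base field. As \<open>of_ac\<close> inverts the embedding on its range,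
  this is meaningful for \<open>y ^ (q * q) = y\<close>, where \<open>y + y ^ q\<close> is fixed by
  Frobenius.\<close>

definition tr :: "'a alg_closure \<Rightarrow> 'a" where "tr y = of_ac (y + y ^ q)"

lemma to_ac_tr:
  assumes "y ^ (q * q) = y"
  shows "to_ac (tr y) = y + y ^ q"
  unfolding tr_def
proof (rule to_ac_of_ac)
  show "y + y ^ q \<in> range to_ac"
    unfolding range_to_ac_iff[symmetric] CARD_eq frobenius_add
    using assms by (simp add: add.commute flip: power_mult)
qed

text \<open>A binomial of degree \<open>q < n\<close> cannot vanish at \<open>n\<close> points. The
  case \<open>c = - 1\<close> supplies \<open>\<theta>\<close>, an element moved by Frobenius, and
  \<open>c = 1\<close> supplies \<open>\<omega>\<close>, an element of nonzero trace.\<close>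

lemma ex_x_not_root: 
  assumes "q > 2"
  shows "\<exists>j<n. x j ^ q + c * x j \<noteq> 0"
proof (rule ccontr)
  assume *: "\<not> ?thesis"
  have "3 * q \<le> q * q" using assms by (intro mult_right_mono) auto
  then have "q < n" using q_mult_q assms by linarith
  define p where "p = monom 1 q + monom c 1"
  have "degree p \<le> q" unfolding p_def
    by (rule degree_add_le) (use q_gt_1 in \<open>auto intro: order_trans[OF degree_monom_le]\<close>)
  then have "p = 0"
    using \<open>q < n\<close> * by (intro poly_eq_0_if_vanishes) (auto simp: p_def poly_monom)
  moreover have "poly.coeff p q = 1" using q_gt_1 by (simp add: p_def)
  ultimately show False by simp
qed

end

subsection \<open>The BCH parity checks\<close>

definition independent_rows :: "nat \<Rightarrow> nat \<Rightarrow> (nat \<Rightarrow> nat \<Rightarrow> 'a :: field) \<Rightarrow> bool" where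
  "independent_rows n m h \<longleftrightarrow>
     (\<forall>a. (\<forall>j<n. (\<Sum>s<m. a s * h s j) = 0) \<longrightarrow> (\<forall>s<m. a s = 0))"

locale bch_code = quadratic_extension q n x
  for q n and x :: "nat \<Rightarrow> 'a :: {field, finite} alg_closure" +
  fixes \<theta> \<omega> :: "'a alg_closure"
  assumes q_gt_2: "q > 2"
    and theta: "\<theta> ^ (q * q) = \<theta>" "\<theta> ^ q \<noteq> \<theta>"
    and omega: "\<omega> ^ (q * q) = \<omega>" "\<omega> + \<omega> ^ q \<noteq> 0"
begin

text \<open>For \<open>f > 0\<close> the rows \<open>2 f - 1\<close> and \<open>2 f\<close> below realise the exponent \<open>b + f\<close> with the
  multipliers \<open>1\<close> and \<open>\<theta>\<close>, which form a basis of the quadratic extension. The exponent \<open>b\<close> itself, for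
  \<open>b = 0\<close> and \<open>b = q + 1\<close>, is fixed by Frobenius and needs only one row, with a multiplier \<open>\<omega>\<close> of
  nonzero trace.\<close>

definition multiplier :: "nat \<Rightarrow> 'a alg_closure" where
  "multiplier s = (if s = 0 then \<omega> else if odd s then 1 else \<theta>)"

definition trace_row :: "nat \<Rightarrow> nat \<Rightarrow> nat \<Rightarrow> 'a" where
  "trace_row b s j = tr (multiplier s * x j ^ (b + (s + 1) div 2))"

text \<open>The checks \<open>H\<^sub>1\<close> come first and \<open>H\<^sub>0\<close> after them,
  to match the index ranges \<open>r < m1\<close> and \<open>m1 \<le> r < m0 + m1\<close> of the
  generator construction.\<close>

definition bch_row :: "nat \<Rightarrow> nat \<Rightarrow> 'a" where
  "bch_row s = (if s < 2 * q - 3 then trace_row (q + 1) s else trace_row 0 (s - (2 * q - 3)))"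

text \<open>The element of the quadratic extension with coordinates taken from \<open>a\<close>. It
  collects the coefficients of all rows with exponent \<open>b + g\<close>, so that by linearity
  these rows contribute a single trace.\<close>

definition coord :: "(nat \<Rightarrow> 'a) \<Rightarrow> nat \<Rightarrow> 'a alg_closure" where
  "coord a g = (if g = 0 then to_ac (a 0) * \<omega> else to_ac (a (2 * g - 1)) + to_ac (a (2 * g)) * \<theta>)"

lemma to_ac_trace_row:
  assumes "j < n"
  shows "to_ac (trace_row b s j) = multiplier s * x j ^ (b + (s + 1) div 2) +
    (multiplier s * x j ^ (b + (s + 1) div 2)) ^ q"
proof -
  have "(x j ^ e) ^ (q * q) = x j ^ e" for e
    using frobenius_x_twice[OF assms] by (metis power_commutes power_mult mult.commute)
  then show ?thesis
    unfolding trace_row_def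
    by (intro to_ac_tr) (simp add: power_mult_distrib multiplier_def theta omega)
qed

lemma sum_trace_row:
  assumes "j < n"
  shows "to_ac (\<Sum>s<2 * Q + 1. a s * trace_row b s j) =
    (\<Sum>g\<le>Q. coord a g * x j ^ (b + g) + (coord a g * x j ^ (b + g)) ^ q)"
proof (induction Q)
  case 0
  show ?case
    by (simp add: to_ac_trace_row assms coord_def multiplier_def power_mult_distrib algebra_simps)
next
  case (Suc Q)
  have "(\<Sum>s<2 * Suc Q + 1. a s * trace_row b s j) = (\<Sum>s<2 * Q + 1. a s * trace_row b s j) +
     a (2 * Q + 1) * trace_row b (2 * Q + 1) j + a (2 * Q + 2) * trace_row b (2 * Q + 2) j"
    by simp
  moreover have "to_ac (a (2 * Q + 1) * trace_row b (2 * Q + 1) j + a (2 * Q + 2) * trace_row b (2 * Q + 2) j)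
    = coord a (Suc Q) * x j ^ (b + Suc Q) + (coord a (Suc Q) * x j ^ (b + Suc Q)) ^ q"
    by (simp add: to_ac_trace_row assms coord_def multiplier_def power_mult_distrib frobenius_add algebra_simps)
  ultimately show ?case using Suc.IH by (simp add: add.assoc)
qed

text \<open>\<open>\<theta>\<close> is moved by Frobenius and so lies outside the base field; hence
  \<open>1\<close> and \<open>\<theta>\<close> are independent over it. For \<open>g = 0\<close>
  only the trace of the coordinate is assumed to vanish, which suffices as \<open>\<omega>\<close>
  has nonzero trace.\<close>

lemma coord_eq_0_imp:
  assumes "coord a 0 + coord a 0 ^ q = 0" and "\<And>g. 0 < g \<Longrightarrow> g \<le> Q \<Longrightarrow> coord a g = 0"
    and s: "s < 2 * Q + 1"
  shows "a s = 0"
proof (cases "s = 0")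
  case True
  have "to_ac (a 0) * (\<omega> + \<omega> ^ q) = 0"
    using assms(1) by (simp add: coord_def power_mult_distrib algebra_simps)
  then show ?thesis using omega True by simp
next
  case False
  define g where "g = (s + 1) div 2"
  have g: "0 < g" "g \<le> Q" using False s by (auto simp: g_def)
  have c: "to_ac (a (2 * g - 1)) + to_ac (a (2 * g)) * \<theta> = 0"
    using assms(2)[OF g] g by (simp add: coord_def)
  have a2: "a (2 * g) = 0"
  proof (rule ccontr)
    assume "a (2 * g) \<noteq> 0"
    then have "\<theta> = to_ac (- a (2 * g - 1) / a (2 * g))"
      using c by (simp add: field_simps eq_neg_iff_add_eq_0)
    then have "\<theta> ^ q = \<theta>" by (metis frobenius_to_ac)
    then show False using theta by simp
  qed
  moreover have "a (2 * g - 1) = 0" using c a2 by simp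
  moreover have "s = 2 * g \<or> s = 2 * g - 1" using False by (auto simp: g_def)
  ultimately show ?thesis by blast
qed

text \<open>Since \<open>x j ^ (q * q) = x j\<close>, the summand \<open>q * q\<close> of the
  exponent \<open>(q + 1 + g) * q\<close> may be replaced by \<open>1\<close>. This keeps the
  exponents below \<open>n\<close> in the independence proof.\<close>

lemma frobenius_shifted_power:
  assumes "j < n"
  shows "(x j ^ (q + 1 + g)) ^ q = x j ^ (q + 1 + q * g)"
proof -
  have "(q + 1 + g) * q = q * q + q + q * g" by (simp add: algebra_simps)
  then have "(x j ^ (q + 1 + g)) ^ q = x j ^ (q * q + q + q * g)"
    by (simp only: power_mult[symmetric])
  also have "\<dots> = x j ^ (q + 1 + q * g)"
    by (simp add: power_add frobenius_x_twice assms)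
  finally show ?thesis .
qed

lemma sum_lessThan_add: "(\<Sum>s<m + k. f s) = (\<Sum>s<m. f s) + (\<Sum>s<k. f (m + s :: nat) :: 'c :: comm_monoid_add)"
  by (induction k) (simp_all add: add.assoc)

text \<open>A combination of the rows takes the values of a polynomial \<open>P\<close> of degree
  below \<open>n\<close> at the \<open>n\<close> points \<open>x j\<close>. If it vanishes, then
  \<open>P = 0\<close>, and the coordinates are read off from the coefficients of
  \<open>P\<close>.\<close>

lemma independent_bch_rows: "independent_rows n (4 * q - 4) bch_row"
  unfolding independent_rows_def
proof (intro allI impI)
  fix a s
  assume zero: "\<forall>j<n. (\<Sum>s<4 * q - 4. a s * bch_row s j) = 0" and s: "s < 4 * q - 4"
  define a' where "a' = (\<lambda>s. a (2 * q - 3 + s))"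
  define P where "P = (\<Sum>g\<le>q - 2. monom (coord a g) (q + 1 + g) + monom (coord a g ^ q) (q + 1 + q * g)) +
    (\<Sum>g\<le>q - 1. monom (coord a' g) g + monom (coord a' g ^ q) (q * g))"
  have qq: "q * q = q + q * (q - 2) + q" "q * q = q * (q - 1) + q" 
    using q_gt_2 by (auto simp: algebra_simps diff_mult_distrib2)
  have m: "2 * q - 3 = 2 * (q - 2) + 1" "2 * q - 1 = 2 * (q - 1) + 1" "4 * q - 4 = (2 * q - 3) + (2 * q - 1)"
    using q_gt_2 by auto
  have vanish: "poly P (x j) = 0" if j: "j < n" for j
  proof -
    have "(\<Sum>s<4 * q - 4. a s * bch_row s j) =
      (\<Sum>s<2 * q - 3. a s * bch_row s j) + (\<Sum>s<2 * q - 1. a' s * bch_row (2 * q - 3 + s) j)"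
      unfolding m(3) sum_lessThan_add a'_def ..
    also have "\<dots> = (\<Sum>s<2 * (q - 2) + 1. a s * trace_row (q + 1) s j) + (\<Sum>s<2 * (q - 1) + 1. a' s * trace_row 0 s j)"
      unfolding m(2)[symmetric] m(1)[symmetric] by (simp add: bch_row_def)
    finally have "0 = to_ac \<dots>" using zero j by simp
    also have "\<dots> = poly P (x j)"
      unfolding to_ac_add sum_trace_row[OF j] P_def
      by (simp only: poly_add poly_sum poly_monom power_mult_distrib frobenius_shifted_power[OF j] add_0)
         (simp only: power_mult[symmetric] mult.commute[of q])
    finally show ?thesis by simp
  qed
  have bound: "q + 1 + q * g < n" if "g \<le> q - 2" for g
  proof -
    have "q * g \<le> q * (q - 2)" using that by simp
    then show ?thesis using qq q_mult_q q_gt_2 by linarith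
  qed
  have bound': "q * g < n" if "g \<le> q - 1" for g
  proof -
    have "q * g \<le> q * (q - 1)" using that by simp
    then show ?thesis using qq q_mult_q q_gt_2 by linarith
  qed
  have le: "g \<le> q * g" for g using q_gt_2 by simp
  have "degree P < n"
  proof -
    have "q + 1 + g \<le> n - 1" "q + 1 + q * g \<le> n - 1" if "g \<le> q - 2" for g
      using bound[OF that] le[of g] by linarith+
    moreover have "g \<le> n - 1" "q * g \<le> n - 1" if "g \<le> q - 1" for g
      using bound'[OF that] le[of g] by linarith+
    ultimately have "degree P \<le> n - 1"
      unfolding P_def
      by (intro degree_add_le degree_sum_le order_trans[OF degree_monom_le]) (simp_all only: finite_atMost atMost_iff)
    then show ?thesis using n_pos by linarith
  qed
  then have P0: "P = 0" using vanish by (rule poly_eq_0_if_vanishes)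
  have not_multiple: "q * g \<noteq> q + 1 + h" if "h \<le> q - 2" for g h
  proof
    assume "q * g = q + 1 + h"
    then have "q dvd q + 1 + h" by (metis dvd_triv_left)
    then have "q dvd 1 + h" by (metis add.assoc dvd_add_triv_left_iff)
    then show False using that q_gt_2 by (auto dest: dvd_imp_le)
  qed
  have not_multiple': "q * g \<noteq> h" if "0 < h" "h \<le> q - 1" for g h
    using that q_gt_2 by (cases g) auto
  have coeff_P: "poly.coeff P c = (\<Sum>g\<le>q - 2. if q + 1 + g = c then coord a g else 0) +
      (\<Sum>g\<le>q - 2. if q + 1 + q * g = c then coord a g ^ q else 0) +
      (\<Sum>g\<le>q - 1. if g = c then coord a' g else 0) +
      (\<Sum>g\<le>q - 1. if q * g = c then coord a' g ^ q else 0)" for c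
    unfolding P_def by (simp add: coeff_sum sum.distrib add.assoc)
  \<comment> \<open>At the exponents \<open>q + 1\<close> and \<open>0\<close>, which Frobenius
    fixes, the two conjugate terms collide and only the trace of the coordinate is visible. The
    exponents \<open>q + 1 + h\<close> and \<open>h\<close> with \<open>h > 0\<close> carry a single
    term.\<close>
  have "coord a 0 + coord a 0 ^ q = poly.coeff P (q + 1)"
    unfolding coeff_P using q_gt_2 not_multiple[of 0] by (simp add: if_distrib)
  moreover have "coord a h = poly.coeff P (q + 1 + h)" if h: "0 < h" "h \<le> q - 2" for h
    unfolding coeff_P using q_gt_2 h not_multiple[of h] not_multiple'[of h] by simp
  ultimately have "a t = 0" if "t < 2 * q - 3" for t
    using that coord_eq_0_imp[of a "q - 2" t] m(1) P0 by simp
  moreover have "coord a' 0 + coord a' 0 ^ q = poly.coeff P 0"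
    unfolding coeff_P using q_gt_2 by simp
  moreover have "coord a' h = poly.coeff P h" if h: "0 < h" "h \<le> q - 1" for h
  proof -
    have "q + 1 + g \<noteq> h" for g using h by simp
    then show ?thesis
      unfolding coeff_P using q_gt_2 h not_multiple'[of h] by simp
  qed
  ultimately have "a' t = 0" if "t < 2 * q - 1" for t
    using that coord_eq_0_imp[of a' "q - 1" t] m(2) P0 by simp
  show "a s = 0"
  proof (cases "s < 2 * q - 3")
    case False
    then show ?thesis using s \<open>\<And>t. t < 2 * q - 1 \<Longrightarrow> a' t = 0\<close>[of "s - (2 * q - 3)"] m(3)
      by (simp add: a'_def)
  qed fact
qed

subsection \<open>The BCH bound\<close>

definition syndrome :: "(nat \<Rightarrow> 'a) \<Rightarrow> nat \<Rightarrow> 'a alg_closure" where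
  "syndrome c e = (\<Sum>j<n. to_ac (c j) * x j ^ e)"

lemma bch_bound:
  assumes zero: "\<And>e. e < m \<Longrightarrow> syndrome c (b + e) = 0" and c: "\<exists>j<n. c j \<noteq> 0"
  shows "m < card {j. j < n \<and> c j \<noteq> 0}"
proof (rule ccontr)
  let ?S = "{j. j < n \<and> c j \<noteq> 0}"
  assume *: "\<not> ?thesis"
  obtain i where i: "i < n" "c i \<noteq> 0" using c by blast
  \<comment> \<open>Pairing the word with \<open>X\<^sup>b P\<close>, where \<open>P\<close> vanishes on the support except at \<open>i\<close>, isolates \<open>c i\<close>.\<close>
  define P where "P = (\<Prod>j\<in>?S - {i}. [:- x j, 1:])"
  have "degree P = card (?S - {i})"
    unfolding P_def by (subst degree_prod_sum_eq) auto
  also have "\<dots> < card ?S" using i by (intro psubset_card_mono) auto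
  finally have deg: "degree P < m" using * by linarith
  have "(\<Sum>j<n. to_ac (c j) * x j ^ b * poly P (x j)) =
    (\<Sum>j<n. \<Sum>e\<le>degree P. poly.coeff P e * (to_ac (c j) * x j ^ (b + e)))"
    by (simp add: poly_altdef sum_distrib_left power_add mult_ac)
  also have "\<dots> = (\<Sum>e\<le>degree P. poly.coeff P e * syndrome c (b + e))"
    unfolding syndrome_def sum_distrib_left by (rule sum.swap)
  also have "\<dots> = 0" using deg zero by simp
  finally have "(\<Sum>j<n. to_ac (c j) * x j ^ b * poly P (x j)) = 0" .
  moreover have "to_ac (c j) * x j ^ b * poly P (x j) = 0" if "j < n" "j \<noteq> i" for j
    using that by (auto simp: P_def poly_prod)
  ultimately have "to_ac (c i) * x i ^ b * poly P (x i) = 0"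
    using i by (subst (asm) sum.remove[of _ i]) (auto simp: sum.neutral)
  moreover have "poly P (x i) \<noteq> 0"
    using inj_on_x i by (auto simp: P_def poly_prod inj_on_def)
  ultimately show False using i by simp
qed

lemma syndrome_frobenius: "syndrome c e ^ q = (\<Sum>j<n. to_ac (c j) * (x j ^ e) ^ q)"
  by (simp add: syndrome_def frobenius_sum power_mult_distrib)

text \<open>The multipliers \<open>1\<close> and \<open>\<theta>\<close> give two linear equations
  in \<open>S\<close> and \<open>S ^ q\<close> with determinant
  \<open>\<theta> ^ q - \<theta>\<close>. For \<open>g = 0\<close> the syndrome is fixed by
  Frobenius, so the one check says that the trace of \<open>\<omega>\<close> times \<open>S\<close>
  vanishes.\<close>

lemma syndrome_eq_0:
  assumes zero: "\<And>s. s < 2 * Q + 1 \<Longrightarrow> (\<Sum>j<n. trace_row b s j * c j) = 0"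
    and b: "b = 0 \<or> b = q + 1" and g: "g \<le> Q"
  shows "syndrome c (b + g) = 0"
proof -
  define S where "S = syndrome c (b + g)"
  have row: "multiplier s * S + multiplier s ^ q * S ^ q = 0" if "s < 2 * Q + 1" "(s + 1) div 2 = g" for s
  proof -
    have "0 = to_ac (\<Sum>j<n. trace_row b s j * c j)" using zero that by simp
    also have "\<dots> = (\<Sum>j<n. multiplier s * (to_ac (c j) * x j ^ (b + g)) +
        multiplier s ^ q * (to_ac (c j) * (x j ^ (b + g)) ^ q))"
      unfolding to_ac_sum
      by (intro sum.cong) (use that in \<open>simp_all add: to_ac_trace_row power_mult_distrib algebra_simps\<close>)
    also have "\<dots> = multiplier s * S + multiplier s ^ q * S ^ q"
      unfolding sum.distrib sum_distrib_left[symmetric] S_def syndrome_frobenius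
      by (simp add: syndrome_def)
    finally show ?thesis by simp
  qed
  have "S = 0"
  proof (cases "g = 0")
    case True
    have "(x j ^ b) ^ q = x j ^ b" if "j < n" for j
      using b frobenius_shifted_power[OF that, of 0] by auto
    then have "S ^ q = S" unfolding S_def syndrome_frobenius using True by (simp add: syndrome_def)
    then have "(\<omega> + \<omega> ^ q) * S = 0" using row[of 0] True by (simp add: multiplier_def algebra_simps)
    then show ?thesis using omega by simp
  next
    case False
    have "S ^ q + S = 0" using row[of "2 * g - 1"] False g by (simp add: multiplier_def add.commute)
    then have "S ^ q = - S" by (simp add: eq_neg_iff_add_eq_0)
    moreover have "\<theta> * S + \<theta> ^ q * S ^ q = 0" using row[of "2 * g"] False g by (simp add: multiplier_def)
    ultimately have "(\<theta> - \<theta> ^ q) * S = 0" by (simp add: left_diff_distrib)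
    then show ?thesis using theta by auto
  qed
  then show ?thesis by (simp add: S_def)
qed

lemma syndrome_low:
  assumes "\<And>s. s \<in> {2 * q - 3..<4 * q - 4} \<Longrightarrow> (\<Sum>j<n. bch_row s j * c j) = 0" and "e < q"
  shows "syndrome c e = 0"
proof -
  have "(\<Sum>j<n. trace_row 0 s j * c j) = 0" if "s < 2 * (q - 1) + 1" for s
  proof -
    have "2 * q - 3 + s < 4 * q - 4" using that q_gt_2 by linarith
    then have "(\<Sum>j<n. bch_row (2 * q - 3 + s) j * c j) = 0" by (intro assms(1)) auto
    then show ?thesis unfolding bch_row_def by (simp del: add_diff_assoc2)
  qed
  from syndrome_eq_0[OF this, of e] assms(2) show ?thesis by simp
qed

lemma syndrome_high:
  assumes "\<And>s. s < 2 * q - 3 \<Longrightarrow> (\<Sum>j<n. bch_row s j * c j) = 0" and "e < q - 1"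
  shows "syndrome c (q + 1 + e) = 0"
proof -
  have "(\<Sum>j<n. trace_row (q + 1) s j * c j) = 0" if "s < 2 * (q - 2) + 1" for s
    using assms(1)[of s] that q_gt_2 by (simp add: bch_row_def)
  from syndrome_eq_0[OF this, of e] assms(2) show ?thesis by simp
qed

lemma bch_weight_low:
  assumes "\<And>s. s \<in> {2 * q - 3..<4 * q - 4} \<Longrightarrow> (\<Sum>j<n. bch_row s j * c j) = 0" and "\<exists>j<n. c j \<noteq> 0"
  shows "q + 1 \<le> card {j. j < n \<and> c j \<noteq> 0}"
  using bch_bound[of q c 0] syndrome_low[of c, OF assms(1)] assms(2) by simp

lemma bch_weight_high:
  assumes "\<And>s. s < 2 * q - 3 \<Longrightarrow> (\<Sum>j<n. bch_row s j * c j) = 0" and "\<exists>j<n. c j \<noteq> 0"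
  shows "q \<le> card {j. j < n \<and> c j \<noteq> 0}"
  using bch_bound[of "q - 1" c "q + 1"] syndrome_high[of c, OF assms(1)] assms(2) by simp

lemma bch_weight_both:
  assumes "\<And>s. s < 4 * q - 4 \<Longrightarrow> (\<Sum>j<n. bch_row s j * c j) = 0" and "\<exists>j<n. c j \<noteq> 0"
  shows "2 * q + 1 \<le> card {j. j < n \<and> c j \<noteq> 0}"
proof -
  have low: "syndrome c e = 0" if "e < q" for e
    by (rule syndrome_low[OF _ that]) (use assms(1) in auto)
  have high: "syndrome c (q + 1 + e) = 0" if "e < q - 1" for e
    by (rule syndrome_high[OF _ that]) (use assms(1) in auto)
  \<comment> \<open>The exponent \<open>q\<close> fills the gap between the zeros
    \<open>0, ..., q - 1\<close> and \<open>q + 1, ..., 2 q - 1\<close>, which yields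
    \<open>2 q\<close> consecutive zeros.\<close>
  have "syndrome c q = syndrome c 1 ^ q" unfolding syndrome_frobenius by (simp add: syndrome_def)
  then have mid: "syndrome c q = 0" using low[of 1] q_gt_2 by simp
  have "syndrome c e = 0" if "e < 2 * q" for e
    using low[of e] mid high[of "e - (q + 1)"] that by (cases "e < q"; cases "e = q") auto
  then show ?thesis using bch_bound[of "2 * q" c 0] assms(2) by simp
qed

end

subsection \<open>Completion to a basis\<close>

text \<open>By counting, \<open>m < n\<close> rows do not span: they have at most
  \<open>CARD('a) ^ m\<close> combinations. A vector outside the span is appended until there are
  \<open>n\<close> rows.\<close>

lemma extend_independent_rows:
  fixes h :: "nat \<Rightarrow> nat \<Rightarrow> 'a :: {field, finite}"
  assumes "independent_rows n m h" and "m \<le> n"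
  obtains h' where "\<And>s. s < m \<Longrightarrow> h' s = h s" and "independent_rows n n h'"
  using assms(2) assms(1)
proof (induction m arbitrary: h thesis rule: inc_induct)
  case base
  then show ?case by blast
next
  case (step m)
  let ?F = "\<lambda>a. \<lambda>j\<in>{..<n}. \<Sum>s<m. a s * h s j"
  have "card (?F ` ({..<m} \<rightarrow>\<^sub>E UNIV)) \<le> CARD('a) ^ m"
    using card_image_le[of "{..<m} \<rightarrow>\<^sub>E (UNIV :: 'a set)" ?F] by (simp add: card_PiE finite_PiE)
  also have "\<dots> < CARD('a) ^ n"
    using step.hyps card_mono[of "UNIV :: 'a set" "{0, 1}"] by (intro power_strict_increasing) auto
  also have "\<dots> = card ({..<n} \<rightarrow>\<^sub>E (UNIV :: 'a set))" by (simp add: card_PiE)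
  finally have "\<not> ({..<n} \<rightarrow>\<^sub>E (UNIV :: 'a set)) \<subseteq> ?F ` ({..<m} \<rightarrow>\<^sub>E UNIV)"
    using card_mono[of "?F ` ({..<m} \<rightarrow>\<^sub>E UNIV)" "{..<n} \<rightarrow>\<^sub>E (UNIV :: 'a set)"]
    by (auto simp: finite_PiE)
  then obtain w where w: "w \<in> {..<n} \<rightarrow>\<^sub>E (UNIV :: 'a set)" "w \<notin> ?F ` ({..<m} \<rightarrow>\<^sub>E UNIV)"
    by blast
  have notin: "\<exists>j<n. w j \<noteq> (\<Sum>s<m. a s * h s j)" for a
  proof (rule ccontr)
    assume "\<not> ?thesis"
    then have "w j = ?F (restrict a {..<m}) j" for j
      using PiE_arb[OF w(1), of j] by (cases "j < n") simp_all
    then have "w = ?F (restrict a {..<m})" by (rule ext)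
    then have "w \<in> ?F ` ({..<m} \<rightarrow>\<^sub>E UNIV)" by (rule image_eqI[of _ ?F "restrict a {..<m}"]) simp
    then show False using w(2) by contradiction
  qed
  define g where "g = h(m := w)"
  have "a s = 0" if zero: "\<forall>j<n. (\<Sum>s<Suc m. a s * g s j) = 0" and s: "s < Suc m" for a s
  proof -
    have sum: "(\<Sum>s<m. a s * h s j) + a m * w j = 0" if "j < n" for j
      using zero that by (simp add: g_def)
    have am: "a m = 0"
    proof (rule ccontr)
      assume am: "a m \<noteq> 0"
      obtain j where "j < n" "w j \<noteq> (\<Sum>s<m. (- 1 / a m * a s) * h s j)"
        using notin[of "\<lambda>s. - 1 / a m * a s"] by blast
      moreover have "(\<Sum>s<m. (- 1 / a m * a s) * h s j) = - 1 / a m * (\<Sum>s<m. a s * h s j)"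
        by (simp only: sum_distrib_left mult.assoc)
      moreover have "(\<Sum>s<m. a s * h s j) = - (a m * w j)"
        using sum \<open>j < n\<close> by (simp add: eq_neg_iff_add_eq_0)
      ultimately show False using am by simp
    qed
    then show ?thesis
      using sum step.prems(2) s by (auto simp: independent_rows_def less_Suc_eq)
  qed
  then have "independent_rows n (Suc m) g" unfolding independent_rows_def by blast
  then obtain h' where "\<And>s. s < Suc m \<Longrightarrow> h' s = g s" "independent_rows n n h'"
    using step.IH[of g] by blast
  then show ?case using step.prems(1)[of h'] by (simp add: g_def)
qed

lemma independent_rows_inverse:
  fixes h :: "nat \<Rightarrow> nat \<Rightarrow> 'a :: field"
  assumes "independent_rows n n h"
  obtains b where "\<And>r s. r < n \<Longrightarrow> s < n \<Longrightarrow> (\<Sum>j<n. h r j * b s j) = (if r = s then 1 else 0)"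
    and "\<And>i j. i < n \<Longrightarrow> j < n \<Longrightarrow> (\<Sum>s<n. b s i * h s j) = (if i = j then 1 else 0)"
proof -
  \<comment> \<open>Transposed, so that a kernel vector of \<open>A\<close> is a linear relation
    between the rows \<open>h s\<close>. The dual basis is the inverse of \<open>A\<close>.\<close>
  define A where "A = mat n n (\<lambda>(i, j). h j i)"
  have A: "A \<in> carrier_mat n n" by (simp add: A_def)
  have "det A \<noteq> 0"
  proof
    assume "det A = 0"
    then obtain v where v: "v \<in> carrier_vec n" "v \<noteq> 0\<^sub>v n" "A *\<^sub>v v = 0\<^sub>v n"
      using det_0_iff_vec_prod_zero_field[OF A] by blast
    have "(\<Sum>s<n. v $ s * h s j) = (A *\<^sub>v v) $ j" if "j < n" for j
      using that v(1) by (auto simp: A_def scalar_prod_def mult.commute lessThan_atLeast0 intro!: sum.cong)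
    then have "v $ s = 0" if "s < n" for s using v(3) that assms by (simp add: independent_rows_def)
    then have "v = 0\<^sub>v n" using v(1) by (intro eq_vecI) auto
    then show False using v(2) by blast
  qed
  from det_non_zero_imp_unit[OF A this, unfolded Units_def, of "()"]
  obtain B where B: "B \<in> carrier_mat n n" "B * A = 1\<^sub>m n" "A * B = 1\<^sub>m n"
    by (auto simp: ring_mat_def)
  show thesis
  proof (rule that[of "\<lambda>s j. B $$ (s, j)"])
    fix r s assume rs: "r < n" "s < n"
    have "(B * A) $$ (s, r) = (\<Sum>j<n. h r j * B $$ (s, j))"
      using rs B(1) by (auto simp: A_def scalar_prod_def mult.commute lessThan_atLeast0 intro!: sum.cong)
    then show "(\<Sum>j<n. h r j * B $$ (s, j)) = (if r = s then 1 else 0)"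
      using rs B(2) by auto
  next
    fix i j assume ij: "i < n" "j < n"
    have "(A * B) $$ (j, i) = (\<Sum>s<n. B $$ (s, i) * h s j)"
      using ij B(1) by (auto simp: A_def scalar_prod_def mult.commute lessThan_atLeast0 intro!: sum.cong)
    then show "(\<Sum>s<n. B $$ (s, i) * h s j) = (if i = j then 1 else 0)"
      using ij B(3) by auto
  qed
qed

subsection \<open>Basic matrices and their constraint lengths\<close>

lemma code_of_iff:
  "v \<in> code_of G \<longleftrightarrow> dim_vec v = dim_col G \<and>
    (\<exists>u. \<forall>j<dim_col G. v $ j = (\<Sum>i<dim_row G. u i * G $$ (i, j)))"
proof safe
  fix u assume "\<forall>j<dim_col G. v $ j = (\<Sum>i<dim_row G. u i * G $$ (i, j))" "dim_vec v = dim_col G"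
  then have "v = transpose_mat G *\<^sub>v vec (dim_row G) u"
    by (intro eq_vecI) (auto simp: scalar_prod_def lessThan_atLeast0 mult.commute intro!: sum.cong)
  then show "v \<in> code_of G" by (auto simp: code_of_def)
next
  assume "v \<in> code_of G"
  then obtain u where u: "u \<in> carrier_vec (dim_row G)" "v = transpose_mat G *\<^sub>v u"
    by (auto simp: code_of_def)
  then show "dim_vec v = dim_col G" by simp
  show "\<exists>u. \<forall>j<dim_col G. v $ j = (\<Sum>i<dim_row G. u i * G $$ (i, j))"
    using u by (intro exI[of _ "\<lambda>i. u $ i"])
      (auto simp: scalar_prod_def lessThan_atLeast0 mult.commute intro!: sum.cong)
qed

lemma basic_mat_iff:
  "basic_mat G \<longleftrightarrow> (\<exists>h. \<forall>i<dim_row G. \<forall>l<dim_row G.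
     (\<Sum>j<dim_col G. G $$ (i, j) * h j l) = (if i = l then 1 else 0))"
proof
  assume "basic_mat G"
  then obtain H where H: "H \<in> carrier_mat (dim_col G) (dim_row G)" "G * H = 1\<^sub>m (dim_row G)"
    by (auto simp: basic_mat_def)
  have "(\<Sum>j<dim_col G. G $$ (i, j) * H $$ (j, l)) = (if i = l then 1 else 0)"
    if "i < dim_row G" "l < dim_row G" for i l
  proof -
    have "(\<Sum>j<dim_col G. G $$ (i, j) * H $$ (j, l)) = (G * H) $$ (i, l)"
      using that H(1) by (auto simp: scalar_prod_def lessThan_atLeast0 intro!: sum.cong)
    then show ?thesis using that H(2) by simp
  qed
  then show "\<exists>h. \<forall>i<dim_row G. \<forall>l<dim_row G. (\<Sum>j<dim_col G. G $$ (i, j) * h j l) = (if i = l then 1 else 0)"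
    by (intro exI[of _ "\<lambda>j l. H $$ (j, l)"]) blast
next
  assume "\<exists>h. \<forall>i<dim_row G. \<forall>l<dim_row G. (\<Sum>j<dim_col G. G $$ (i, j) * h j l) = (if i = l then 1 else 0)"
  then obtain h where h: "\<And>i l. i < dim_row G \<Longrightarrow> l < dim_row G \<Longrightarrow>
      (\<Sum>j<dim_col G. G $$ (i, j) * h j l) = (if i = l then 1 else 0)" by blast
  define H where "H = mat (dim_col G) (dim_row G) (\<lambda>(j, l). h j l)"
  have "G * H = 1\<^sub>m (dim_row G)"
  proof (intro eq_matI)
    fix i l assume "i < dim_row (1\<^sub>m (dim_row G) :: 'a poly mat)" "l < dim_col (1\<^sub>m (dim_row G) :: 'a poly mat)"
    then have il: "i < dim_row G" "l < dim_row G" by auto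
    have "(G * H) $$ (i, l) = (\<Sum>j<dim_col G. G $$ (i, j) * h j l)"
      using il by (auto simp: H_def scalar_prod_def lessThan_atLeast0 intro!: sum.cong)
    then show "(G * H) $$ (i, l) = 1\<^sub>m (dim_row G) $$ (i, l)" using h il by simp
  qed (auto simp: H_def)
  then show "basic_mat G" unfolding basic_mat_def by (intro bexI[of _ H]) (auto simp: H_def)
qed

text \<open>Setting \<open>D = 0\<close> in \<open>G H = 1\<close> gives a right inverse of
  \<open>G(0)\<close>, so the rows of \<open>G(0)\<close> are independent.\<close>

lemma basic_mat_constant_coeffs_independent:
  assumes "basic_mat (G :: 'a :: field poly mat)"
    and zero: "\<And>j. j < dim_col G \<Longrightarrow> (\<Sum>i<dim_row G. a i * poly.coeff (G $$ (i, j)) 0) = 0"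
    and l: "l < dim_row G"
  shows "a l = 0"
proof -
  obtain h where h: "\<And>i l. i < dim_row G \<Longrightarrow> l < dim_row G \<Longrightarrow>
      (\<Sum>j<dim_col G. G $$ (i, j) * h j l) = (if i = l then 1 else 0)"
    using assms(1) unfolding basic_mat_iff by blast
  have "0 = (\<Sum>j<dim_col G. (\<Sum>i<dim_row G. a i * poly.coeff (G $$ (i, j)) 0) * poly.coeff (h j l) 0)"
    using zero by simp
  also have "\<dots> = (\<Sum>i<dim_row G. \<Sum>j<dim_col G. a i * (poly.coeff (G $$ (i, j)) 0 * poly.coeff (h j l) 0))"
    unfolding sum_distrib_right mult.assoc by (rule sum.swap)
  also have "\<dots> = (\<Sum>i<dim_row G. a i * poly.coeff (\<Sum>j<dim_col G. G $$ (i, j) * h j l) 0)"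
    by (simp add: coeff_sum sum_distrib_left coeff_mult_0)
  also have "\<dots> = (\<Sum>i<dim_row G. if i = l then a i else 0)"
    using h l by (intro sum.cong) auto
  also have "\<dots> = a l" using l by simp
  finally show ?thesis by simp
qed

text \<open>Over a finite field, this lets cardinalities stand in for dimensions in the arguments
  below.\<close>

lemma card_span_independent:
  fixes g :: "nat \<Rightarrow> nat \<Rightarrow> 'a :: {field, finite}"
  assumes "\<And>a l. (\<And>j. j < n \<Longrightarrow> (\<Sum>i\<in>Z. a i * g i j) = 0) \<Longrightarrow> l \<in> Z \<Longrightarrow> a l = 0"
    and "finite Z"
  shows "card (range (\<lambda>a. \<lambda>j\<in>{..<n}. \<Sum>i\<in>Z. a i * g i j)) = CARD('a) ^ card Z"
proof -
  let ?F = "\<lambda>a. \<lambda>j\<in>{..<n}. \<Sum>i\<in>Z. a i * g i j"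
  have "inj_on ?F (Z \<rightarrow>\<^sub>E UNIV)"
  proof
    fix a b assume ab: "a \<in> Z \<rightarrow>\<^sub>E UNIV" "b \<in> Z \<rightarrow>\<^sub>E UNIV" "?F a = ?F b"
    have zero: "(\<Sum>i\<in>Z. (a i - b i) * g i j) = 0" if "j < n" for j
      using fun_cong[OF ab(3), of j] that by (simp add: left_diff_distrib sum_subtractf)
    have "a i - b i = 0" if "i \<in> Z" for i
      using assms(1)[of "\<lambda>i. a i - b i" i] zero that by blast
    then show "a = b" using ab(1,2) by (intro ext) (metis PiE_arb right_minus_eq)
  qed
  moreover have "range ?F = ?F ` (Z \<rightarrow>\<^sub>E UNIV)"
  proof safe
    fix a :: "nat \<Rightarrow> 'a"
    have "?F a = ?F (restrict a Z)" by (intro restrict_ext sum.cong) auto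
    then show "?F a \<in> ?F ` (Z \<rightarrow>\<^sub>E UNIV)" by (rule image_eqI[of _ ?F "restrict a Z"]) simp
  qed auto
  ultimately show ?thesis using assms(2) by (simp add: card_image card_PiE)
qed

lemma dim_col_eq_if_code_of_eq:
  assumes "code_of G = code_of G'"
  shows "dim_col G = dim_col G'"
proof -
  have "transpose_mat G *\<^sub>v 0\<^sub>v (dim_row G) \<in> code_of G" by (auto simp: code_of_def)
  then have "transpose_mat G *\<^sub>v 0\<^sub>v (dim_row G) \<in> code_of G'" by (simp only: assms)
  then show ?thesis unfolding code_of_iff by simp
qed

text \<open>The values at \<open>0\<close> of the codewords form a space whose dimension is the number of rows.\<close>

lemma dim_row_eq_if_code_of_eq:
  fixes G G' :: "'a :: {field, finite} poly mat"
  assumes "code_of G = code_of G'" "basic_mat G" "basic_mat G'"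
  shows "dim_row G = dim_row G'"
proof -
  have card: "card ((\<lambda>v :: 'a poly vec. \<lambda>j\<in>{..<dim_col A}. poly.coeff (v $ j) 0) ` code_of A) = CARD('a) ^ dim_row A"
    if A: "basic_mat A" for A :: "'a poly mat"
  proof -
    let ?c = "\<lambda>v :: 'a poly vec. \<lambda>j\<in>{..<dim_col A}. poly.coeff (v $ j) 0"
    let ?F = "\<lambda>a. \<lambda>j\<in>{..<dim_col A}. \<Sum>i<dim_row A. a i * poly.coeff (A $$ (i, j)) 0"
    have "?c ` code_of A = range ?F"
    proof safe
      fix v assume "v \<in> code_of A"
      then obtain u where "\<And>j. j < dim_col A \<Longrightarrow> v $ j = (\<Sum>i<dim_row A. u i * A $$ (i, j))"
        unfolding code_of_iff by blast
      then have "?c v = ?F (\<lambda>i. poly.coeff (u i) 0)"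
        by (intro restrict_ext) (simp add: coeff_sum coeff_mult_0)
      then show "?c v \<in> range ?F" by (rule range_eqI[of _ ?F "\<lambda>i. poly.coeff (u i) 0"])
    next
      fix a
      define v where "v = vec (dim_col A) (\<lambda>j. \<Sum>i<dim_row A. [:a i:] * A $$ (i, j))"
      have "v \<in> code_of A" unfolding code_of_iff v_def by (auto intro!: exI[of _ "\<lambda>i. [:a i:]"])
      moreover have "?F a = ?c v" by (intro restrict_ext) (simp add: v_def coeff_sum)
      ultimately show "?F a \<in> ?c ` code_of A" by (rule rev_image_eqI[of v _ _ ?c])
    qed
    then show ?thesis
      using card_span_independent[where n = "dim_col A" and Z = "{..<dim_row A}" and g = "\<lambda>i j. poly.coeff (A $$ (i, j)) 0"]
        basic_mat_constant_coeffs_independent[OF A] by simp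
  qed
  have "CARD('a) ^ dim_row G = CARD('a) ^ dim_row G'"
    using card[OF assms(2)] card[OF assms(3)] assms(1) dim_col_eq_if_code_of_eq[OF assms(1)] by simp
  moreover have "CARD('a) > 1" using card_mono[of "UNIV :: 'a set" "{0, 1}"] by simp
  ultimately show ?thesis by simp
qed

text \<open>Here \<open>d\<close> bounds the dimension of the space of constant codewords. Hence at
  most \<open>d\<close> rows have degree \<open>0\<close>, and each other row contributes at least
  \<open>1\<close> to the constraint length.\<close>

lemma constraint_length_ge:
  fixes G :: "'a :: {field, finite} poly mat"
  assumes G: "basic_mat G" and cols: "dim_col G > 0"
    and card: "card {w \<in> {..<dim_col G} \<rightarrow>\<^sub>E UNIV. vec (dim_col G) (\<lambda>j. [:w j:]) \<in> code_of G} \<le> CARD('a) ^ d"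
  shows "dim_row G \<le> overall_constraint_length G + d"
proof -
  let ?n = "dim_col G"
  let ?W = "{w \<in> {..<?n} \<rightarrow>\<^sub>E UNIV. vec ?n (\<lambda>j. [:w j:]) \<in> code_of G}"
  define Z where "Z = {i. i < dim_row G \<and> row_degree G i = 0}"
  have Z: "finite Z" "Z \<subseteq> {..<dim_row G}" by (auto simp: Z_def)
  let ?F = "\<lambda>a. \<lambda>j\<in>{..<?n}. \<Sum>i\<in>Z. a i * poly.coeff (G $$ (i, j)) 0"
  have ind: "a l = 0"
    if "\<And>j. j < ?n \<Longrightarrow> (\<Sum>i\<in>Z. a i * poly.coeff (G $$ (i, j)) 0) = 0" "l \<in> Z" for a :: "nat \<Rightarrow> 'a" and l
  proof -
    define a' where "a' i = (if i \<in> Z then a i else 0)" for i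
    have "(\<Sum>i<dim_row G. a' i * poly.coeff (G $$ (i, j)) 0) = (\<Sum>i\<in>Z. a i * poly.coeff (G $$ (i, j)) 0)" for j
      using Z by (intro sum.mono_neutral_cong_right) (auto simp: a'_def)
    then have "a' l = 0"
      using that Z basic_mat_constant_coeffs_independent[OF G, of a' l] by auto
    then show ?thesis using that by (simp add: a'_def)
  qed
  have const: "[:c:] * G $$ (i, j) = [:c * poly.coeff (G $$ (i, j)) 0:]" if "i \<in> Z" "j < ?n" for c i j
  proof -
    have "degree (G $$ (i, j)) \<le> row_degree G i"
      unfolding row_degree_def using that by (intro Max_ge) auto
    then have "degree (G $$ (i, j)) = 0" using that by (simp add: Z_def)
    then show ?thesis by (auto elim: degree_eq_zeroE)
  qed
  have "range ?F \<subseteq> ?W"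
  proof
    fix w assume "w \<in> range ?F"
    then obtain a where w: "w = ?F a" by (rule rangeE)
    have "[:?F a j:] = (\<Sum>i<dim_row G. (if i \<in> Z then [:a i:] else 0) * G $$ (i, j))" if "j < ?n" for j
    proof -
      have "(\<Sum>i<dim_row G. (if i \<in> Z then [:a i:] else 0) * G $$ (i, j)) = (\<Sum>i\<in>Z. [:a i:] * G $$ (i, j))"
        using Z by (intro sum.mono_neutral_cong_right) auto
      also have "\<dots> = (\<Sum>i\<in>Z. [:a i * poly.coeff (G $$ (i, j)) 0:])"
        using const that by (intro sum.cong refl) blast
      also have "\<dots> = [:?F a j:]" using that by (intro poly_eqI) (simp add: coeff_sum coeff_pCons split: nat.split)
      finally show ?thesis ..
    qed
    then have "vec ?n (\<lambda>j. [:w j:]) \<in> code_of G"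
      unfolding code_of_iff w by (auto intro!: exI[of _ "\<lambda>i. if i \<in> Z then [:a i:] else 0"])
    then show "w \<in> ?W" by (simp add: w)
  qed
  moreover have "finite ?W"
    by (rule finite_subset[of _ "{..<?n} \<rightarrow>\<^sub>E UNIV"]) (auto intro: finite_PiE)
  ultimately have "card (range ?F) \<le> card ?W" by (intro card_mono)
  then have "CARD('a) ^ card Z \<le> CARD('a) ^ d"
    using card card_span_independent[where n = ?n and Z = Z and g = "\<lambda>i j. poly.coeff (G $$ (i, j)) 0"] ind Z(1)
    by simp
  moreover have "CARD('a) > 1" using card_mono[of "UNIV :: 'a set" "{0, 1}"] by simp
  ultimately have "card Z \<le> d" by simp
  moreover have "dim_row G - card Z = (\<Sum>i\<in>{..<dim_row G} - Z. 1)" using Z by (simp add: card_Diff_subset)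
  moreover have "\<dots> \<le> (\<Sum>i\<in>{..<dim_row G} - Z. row_degree G i)"
    by (intro sum_mono) (auto simp: Z_def)
  moreover have "\<dots> \<le> overall_constraint_length G"
    unfolding overall_constraint_length_def by (intro sum_mono2) auto
  ultimately show ?thesis by linarith
qed

subsection \<open>Codes of memory one from a pair of dual bases\<close>

text \<open>\<open>h\<close> lists the \<open>m1\<close> checks of \<open>H\<^sub>1\<close>, then
  the \<open>m0\<close> checks of \<open>H\<^sub>0\<close>, then the completion to a basis;
  \<open>b\<close> is the dual basis. By \<open>m1 \<le> m0\<close> each check of
  \<open>H\<^sub>1\<close> gets its own partner in \<open>H\<^sub>0\<close>.\<close>

locale unit_memory_generator =
  fixes h b :: "nat \<Rightarrow> nat \<Rightarrow> 'a :: {field, finite}" and n m0 m1 :: nat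
  assumes dual: "r < n \<Longrightarrow> s < n \<Longrightarrow> (\<Sum>j<n. h r j * b s j) = (if r = s then 1 else 0)"
    and dual': "i < n \<Longrightarrow> j < n \<Longrightarrow> (\<Sum>s<n. b s i * h s j) = (if i = j then 1 else 0)"
    and m1_pos: "0 < m1" and m1_le_m0: "m1 \<le> m0" and m0_m1_le_n: "m0 + m1 \<le> n"
begin

text \<open>The shift by \<open>m0\<close> makes the constant rows start at
  \<open>b (m0 + m1)\<close>. The vectors \<open>b s\<close> with
  \<open>2 * m1 \<le> s < m0 + m1\<close>, dual to the unpaired checks of \<open>H\<^sub>0\<close>,
  occur in no row.\<close>

definition generator :: "'a poly mat" where
  "generator = mat (n - m0) n
     (\<lambda>(i, j). if i < m1 then [:b i j, b (m1 + i) j:] else [:b (i + m0) j:])"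

lemma dim_generator [simp]: "dim_row generator = n - m0" "dim_col generator = n"
  by (simp_all add: generator_def)

lemma generator_index:
  "i < n - m0 \<Longrightarrow> j < n \<Longrightarrow>
    generator $$ (i, j) = (if i < m1 then [:b i j, b (m1 + i) j:] else [:b (i + m0) j:])"
  by (simp add: generator_def)

lemma eq_0_if_parity_checks_0:
  assumes "\<And>r. r < n \<Longrightarrow> (\<Sum>j<n. h r j * d j) = 0" and "i < n"
  shows "d i = 0"
proof -
  have "d i = (\<Sum>j<n. (if i = j then 1 else 0) * d j)"
    using assms(2) by (simp add: if_distrib[of "\<lambda>x. x * _"] cong: if_cong)
  also have "\<dots> = (\<Sum>j<n. \<Sum>s<n. b s i * (h s j * d j))"
    using assms(2) by (intro sum.cong refl) (simp only: lessThan_iff sum_distrib_right mult.assoc flip: dual')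
  also have "\<dots> = (\<Sum>s<n. b s i * (\<Sum>j<n. h s j * d j))"
    unfolding sum_distrib_left by (rule sum.swap)
  finally show ?thesis using assms(1) by simp
qed

lemma b_nonzero: "s < n \<Longrightarrow> \<exists>j<n. b s j \<noteq> 0"
  using dual[of s s] by (metis (no_types, lifting) lessThan_iff mult_zero_right sum.neutral zero_neq_one)

text \<open>The right inverse is constant: its column \<open>l\<close> is the check dual to the
  constant term of row \<open>l\<close>. These checks avoid the indices from \<open>m1\<close> to
  \<open>m0 + m1 - 1\<close>, so they annihilate the terms with \<open>D\<close>.\<close>

lemma generator_basic: "basic_mat generator"
proof -
  let ?l = "\<lambda>l. if l < m1 then l else l + m0"
  have "(\<Sum>j<n. generator $$ (i, j) * [:h (?l l) j:]) = (if i = l then 1 else 0)"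
    if il: "i < n - m0" "l < n - m0" for i l
  proof (rule poly_eqI)
    fix t
    have lt: "?l l < n" using il m0_m1_le_n by auto
    have "poly.coeff (\<Sum>j<n. generator $$ (i, j) * [:h (?l l) j:]) t =
      (\<Sum>j<n. h (?l l) j * poly.coeff (generator $$ (i, j)) t)"
      by (simp add: coeff_sum)
    also have "\<dots> = (if i < m1
      then (if t = 0 then \<Sum>j<n. h (?l l) j * b i j else if t = 1 then \<Sum>j<n. h (?l l) j * b (m1 + i) j else 0)
      else (if t = 0 then \<Sum>j<n. h (?l l) j * b (i + m0) j else 0))"
      using il(1) by (cases t; cases "t - 1") (auto simp: generator_index)
    also have "\<dots> = poly.coeff (if i = l then 1 else 0) t"
      using il lt m0_m1_le_n m1_le_m0 by (auto simp: dual)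
    finally show "poly.coeff (\<Sum>j<n. generator $$ (i, j) * [:h (?l l) j:]) t = poly.coeff (if i = l then 1 else 0) t" .
  qed
  then show ?thesis
    unfolding basic_mat_iff dim_generator by (intro exI[of _ "\<lambda>j l. [:h (?l l) j:]"]) blast
qed

lemma row_degree_generator:
  assumes "i < n - m0"
  shows "row_degree generator i = (if i < m1 then 1 else 0)"
proof -
  have le: "degree (generator $$ (i, j)) \<le> (if i < m1 then 1 else 0)" if "j < n" for j
    using assms that by (simp add: generator_index)
  have "\<exists>j<n. (if i < m1 then 1 else 0) = degree (generator $$ (i, j))"
  proof (cases "i < m1")
    case True
    then obtain j where "j < n" "b (m1 + i) j \<noteq> 0"
      using b_nonzero[of "m1 + i"] m0_m1_le_n m1_le_m0 by auto
    then show ?thesis using True assms by (intro exI[of _ j]) (simp add: generator_index)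
  next
    case False
    then show ?thesis using le[of 0] assms by (intro exI[of _ 0]) simp
  qed
  then show ?thesis
    unfolding row_degree_def using le by (intro Max_eqI) (auto simp: image_iff)
qed

lemma overall_constraint_length_generator: "overall_constraint_length generator = m1"
proof -
  have "overall_constraint_length generator = (\<Sum>i<n - m0. if i < m1 then 1 else 0)"
    unfolding overall_constraint_length_def by (simp add: row_degree_generator)
  also have "\<dots> = (\<Sum>i<m1. 1)"
    using m0_m1_le_n by (intro sum.mono_neutral_cong_right) auto
  finally show ?thesis by simp
qed

lemma memory_generator: "memory generator = 1"
  unfolding memory_def
proof (rule Max_eqI)
  have "row_degree generator 0 = 1" "0 < n - m0" using m1_pos m0_m1_le_n by (auto simp: row_degree_generator)
  then show "1 \<in> row_degree generator ` {..<dim_row generator}" by (metis dim_generator(1) image_eqI lessThan_iff)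
qed (auto simp: row_degree_generator)

text \<open>By duality this is the coordinate along \<open>b r\<close> of the coefficient of
  \<open>D ^ t\<close> in \<open>v\<close>.\<close>

definition parity :: "'a poly vec \<Rightarrow> nat \<Rightarrow> nat \<Rightarrow> 'a" where
  "parity v r t = (\<Sum>j<n. h r j * poly.coeff (v $ j) t)"

lemma parity_codeword:
  fixes v :: "'a poly vec"
  assumes v: "\<And>j. j < n \<Longrightarrow> v $ j = (\<Sum>i<n - m0. u i * generator $$ (i, j))" and r: "r < n"
  shows "parity v r t =
    (if r < m1 then poly.coeff (u r) t
     else if r < 2 * m1 then poly.coeff (pCons 0 (u (r - m1))) t
     else if r < m0 + m1 then 0 else poly.coeff (u (r - m0)) t)"
proof -
  have "parity v r t = (\<Sum>j<n. \<Sum>i<n - m0. h r j * poly.coeff (u i * generator $$ (i, j)) t)"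
    unfolding parity_def by (simp add: v coeff_sum sum_distrib_left)
  also have "\<dots> = (\<Sum>i<n - m0. \<Sum>j<n. h r j * poly.coeff (u i * generator $$ (i, j)) t)"
    by (rule sum.swap)
  also have "\<dots> = (\<Sum>i<n - m0. if i < m1
      then (if r = i then poly.coeff (u i) t else 0) + (if r = m1 + i then poly.coeff (pCons 0 (u i)) t else 0)
      else (if r = i + m0 then poly.coeff (u i) t else 0))"
  proof (intro sum.cong refl)
    fix i assume "i \<in> {..<n - m0}"
    then have i: "i < n - m0" by simp
    show "(\<Sum>j<n. h r j * poly.coeff (u i * generator $$ (i, j)) t) = (if i < m1
      then (if r = i then poly.coeff (u i) t else 0) + (if r = m1 + i then poly.coeff (pCons 0 (u i)) t else 0)
      else (if r = i + m0 then poly.coeff (u i) t else 0))"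
    proof (cases "i < m1")
      case True
      have "poly.coeff (u i * [:b i j, b (m1 + i) j:]) t =
        b i j * poly.coeff (u i) t + b (m1 + i) j * poly.coeff (pCons 0 (u i)) t" for j
        by (simp add: mult.commute[of "u i"] coeff_pCons split: nat.split)
      then have "(\<Sum>j<n. h r j * poly.coeff (u i * generator $$ (i, j)) t) =
        (\<Sum>j<n. h r j * b i j) * poly.coeff (u i) t + (\<Sum>j<n. h r j * b (m1 + i) j) * poly.coeff (pCons 0 (u i)) t"
        using i True by (simp add: generator_index sum.distrib sum_distrib_right distrib_left mult.assoc)
      then show ?thesis using i r True m0_m1_le_n m1_le_m0 by (simp add: dual)
    next
      case False
      then have "(\<Sum>j<n. h r j * poly.coeff (u i * generator $$ (i, j)) t) =
        (\<Sum>j<n. h r j * b (i + m0) j) * poly.coeff (u i) t"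
        using i by (simp add: generator_index sum_distrib_left mult_ac)
      then show ?thesis using i r False by (simp add: dual)
    qed
  qed
  \<comment> \<open>At most one row of the generator involves \<open>b r\<close>. For an unpaired
    check, \<open>2 * m1 \<le> r < m0 + m1\<close>, the index \<open>r - m0\<close> is a dummy whose
    term is \<open>0\<close>.\<close>
  also have "\<dots> = (\<Sum>i\<in>{..<n - m0} \<inter> {if r < m1 then r else if r < 2 * m1 then r - m1 else r - m0}.
      if i < m1
      then (if r = i then poly.coeff (u i) t else 0) + (if r = m1 + i then poly.coeff (pCons 0 (u i)) t else 0)
      else (if r = i + m0 then poly.coeff (u i) t else 0))"
    using m1_le_m0 by (intro sum.mono_neutral_right) (auto split: if_splits)
  also have "\<dots> = (if r < m1 then poly.coeff (u r) t
     else if r < 2 * m1 then poly.coeff (pCons 0 (u (r - m1))) t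
     else if r < m0 + m1 then 0 else poly.coeff (u (r - m0)) t)"
  proof -
    consider "r < m1" | "m1 \<le> r" "r < 2 * m1" | "2 * m1 \<le> r" "r < m0 + m1" | "2 * m1 \<le> r" "m0 + m1 \<le> r"
      by linarith
    then show ?thesis
    proof cases
      case 1
      then have "{..<n - m0} \<inter> {r} = {r}" using m0_m1_le_n by auto
      then show ?thesis using 1 by simp
    next
      case 2
      then obtain i where i: "r = m1 + i" using le_Suc_ex by blast
      then have "{..<n - m0} \<inter> {i} = {i}" using 2 m0_m1_le_n by auto
      then show ?thesis using 2 i m1_pos by simp
    next
      case 3
      then have "r - m0 < m1" "r \<noteq> r - m0" "r \<noteq> m1 + (r - m0)"
        using m1_le_m0 m1_pos by auto
      then show ?thesis using 3 by (cases "r - m0 < n - m0") simp_all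
    next
      case 4
      then obtain i where i: "r = m0 + i" using le_Suc_ex[of m0 r] by auto
      then have "{..<n - m0} \<inter> {i} = {i}" "\<not> i < m1" using 4 r by auto
      then show ?thesis using 4 i m1_pos by simp
    qed
  qed
  finally show ?thesis .
qed

text \<open>Row \<open>r < m1\<close> of the generator is \<open>b r + D b (m1 + r)\<close>, so the
  message coefficient of \<open>D ^ t\<close> in \<open>u r\<close> shows up at check
  \<open>r\<close> at time \<open>t\<close> and at check \<open>m1 + r\<close> one step
  later.\<close>

lemma parity_recurrence:
  assumes "v \<in> code_of generator"
  shows "r < m1 \<Longrightarrow> parity v (m1 + r) (Suc t) = parity v r t"
    and "r \<in> {m1..<m0 + m1} \<Longrightarrow> parity v r 0 = 0"
    and "r \<in> {2 * m1..<m0 + m1} \<Longrightarrow> parity v r t = 0"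
proof -
  obtain u where v: "\<And>j. j < n \<Longrightarrow> v $ j = (\<Sum>i<n - m0. u i * generator $$ (i, j))"
    using assms unfolding code_of_iff dim_generator by blast
  note p = parity_codeword[of v u, OF v]
  show "r < m1 \<Longrightarrow> parity v (m1 + r) (Suc t) = parity v r t"
    and "r \<in> {m1..<m0 + m1} \<Longrightarrow> parity v r 0 = 0"
    and "r \<in> {2 * m1..<m0 + m1} \<Longrightarrow> parity v r t = 0"
    using m1_le_m0 m0_m1_le_n by (auto simp: p)
qed

text \<open>The coefficient of \<open>D\<close> in a constant codeword is \<open>0\<close>, so the
  recurrence forces the checks \<open>r < m1\<close> as well. The word is then determined by the
  \<open>n - m0 - m1\<close> checks of the completion.\<close>

lemma card_constant_codewords:
  "card {w \<in> {..<n} \<rightarrow>\<^sub>E UNIV. vec n (\<lambda>j. [:w j:]) \<in> code_of generator} \<le> CARD('a) ^ (n - m0 - m1)"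
proof -
  let ?W = "{w \<in> {..<n} \<rightarrow>\<^sub>E UNIV. vec n (\<lambda>j. [:w j:]) \<in> code_of generator}"
  let ?p = "\<lambda>w. \<lambda>r\<in>{m0 + m1..<n}. \<Sum>j<n. h r j * w j"
  have zero: "(\<Sum>j<n. h r j * w j) = 0" if w: "w \<in> ?W" and r: "r < m0 + m1" for w r
  proof -
    define v where "v = vec n (\<lambda>j. [:w j:])"
    have v: "v \<in> code_of generator" using w by (simp add: v_def)
    have "parity v (m1 + r) (Suc 0) = 0" by (simp add: parity_def v_def)
    then have "parity v r 0 = 0"
      using parity_recurrence[OF v] r by (cases "r < m1") auto
    then show ?thesis by (simp add: parity_def v_def)
  qed
  have "inj_on ?p ?W"
  proof
    fix w w' assume w: "w \<in> ?W" "w' \<in> ?W" "?p w = ?p w'"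
    have "(\<Sum>j<n. h r j * (w j - w' j)) = 0" if "r < n" for r
    proof (cases "r < m0 + m1")
      case True
      then show ?thesis
        using zero[OF w(1)] zero[OF w(2)] by (simp add: right_diff_distrib sum_subtractf)
    next
      case False
      then show ?thesis using fun_cong[OF w(3), of r] that by (simp add: right_diff_distrib sum_subtractf)
    qed
    then have "w j - w' j = 0" if "j < n" for j
      using eq_0_if_parity_checks_0[of "\<lambda>j. w j - w' j" j] that by blast
    then have "w j = w' j" if "j < n" for j using that by simp
    then show "w = w'" using w(1,2) by (intro PiE_ext[of w "{..<n}" "\<lambda>_. UNIV"]) auto
  qed
  moreover have "?p ` ?W \<subseteq> {m0 + m1..<n} \<rightarrow>\<^sub>E UNIV" by (intro image_subsetI) simp
  ultimately have "card ?W \<le> card ({m0 + m1..<n} \<rightarrow>\<^sub>E (UNIV :: 'a set))"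
    by (rule card_inj_on_le) (simp add: finite_PiE)
  then show ?thesis by (simp add: card_PiE)
qed

text \<open>Any competing matrix has \<open>n - m0\<close> rows, of which at most
  \<open>n - m0 - m1\<close> are constant; the remaining \<open>m1\<close> or more rows have
  positive degree.\<close>

lemma generator_reduced: "reduced_basic_mat generator"
  unfolding reduced_basic_mat_def
proof (intro conjI allI impI generator_basic)
  fix G' assume "basic_mat G' \<and> code_of G' = code_of generator"
  then have G': "basic_mat G'" "code_of G' = code_of generator" by auto
  have col: "dim_col G' = n" using dim_col_eq_if_code_of_eq[OF G'(2)] by simp
  have row: "dim_row G' = n - m0" using dim_row_eq_if_code_of_eq[OF G'(2,1) generator_basic] by simp
  have "dim_row G' \<le> overall_constraint_length G' + (n - m0 - m1)"
    using card_constant_codewords m1_pos m0_m1_le_n by (intro constraint_length_ge G') (simp_all add: col G'(2))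
  then show "overall_constraint_length generator \<le> overall_constraint_length G'"
    using m0_m1_le_n by (simp add: row overall_constraint_length_generator)
qed

lemma wt_ge:
  assumes low: "\<And>c. (\<And>r. r \<in> {m1..<m0 + m1} \<Longrightarrow> (\<Sum>j<n. h r j * c j) = 0) \<Longrightarrow> \<exists>j<n. c j \<noteq> 0 \<Longrightarrow>
      d0 \<le> card {j. j < n \<and> c j \<noteq> 0}"
    and high: "\<And>c. (\<And>r. r < m1 \<Longrightarrow> (\<Sum>j<n. h r j * c j) = 0) \<Longrightarrow> \<exists>j<n. c j \<noteq> 0 \<Longrightarrow>
      d1 \<le> card {j. j < n \<and> c j \<noteq> 0}"
    and both: "\<And>c. (\<And>r. r < m0 + m1 \<Longrightarrow> (\<Sum>j<n. h r j * c j) = 0) \<Longrightarrow> \<exists>j<n. c j \<noteq> 0 \<Longrightarrow>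
      d0 + d1 \<le> card {j. j < n \<and> c j \<noteq> 0}"
    and v: "v \<in> code_of generator" "v \<noteq> 0\<^sub>v (dim_vec v)"
  shows "d0 + d1 \<le> wt v"
proof -
  have dim: "dim_vec v = n" using v(1) unfolding code_of_iff by simp
  define c where "c t j = poly.coeff (v $ j) t" for t j
  have par: "parity v r t = (\<Sum>j<n. h r j * c t j)" for r t by (simp add: parity_def c_def)
  define T where "T = {t. \<exists>j<n. c t j \<noteq> 0}"
  have fin: "finite {t. c t j \<noteq> 0}" for j
    unfolding c_def by (rule finite_subset[of _ "{..degree (v $ j)}"]) (auto intro: le_degree)
  have "T = (\<Union>j<n. {t. c t j \<noteq> 0})" by (auto simp: T_def)
  then have finT: "finite T" using fin by simp
  have "T \<noteq> {}"
  proof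
    assume "T = {}"
    then have "v $ j = 0" if "j < n" for j
      using that by (intro poly_eqI) (auto simp: T_def c_def)
    then have "v = 0\<^sub>v (dim_vec v)" using dim by (intro eq_vecI) auto
    then show False using v(2) by contradiction
  qed
  define s where "s = Min T"
  define N where "N = Max T"
  have s: "s \<in> T" and N: "N \<in> T" using finT \<open>T \<noteq> {}\<close> by (auto simp: s_def N_def)
  have before: "c t j = 0" if "t < s" "j < n" for t j
  proof (rule ccontr)
    assume "c t j \<noteq> 0"
    then have "t \<in> T" using that by (auto simp: T_def)
    then have "s \<le> t" using finT by (simp add: s_def)
    then show False using that by simp
  qed
  have after: "c t j = 0" if "N < t" "j < n" for t j
  proof (rule ccontr)
    assume "c t j \<noteq> 0"
    then have "t \<in> T" using that by (auto simp: T_def)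
    then have "t \<le> N" using finT by (simp add: N_def)
    then show False using that by simp
  qed
  \<comment> \<open>A paired check of \<open>H\<^sub>0\<close> at the lowest time \<open>s\<close>
    repeats a check of the coefficient before it, which is \<open>0\<close>.\<close>
  have par_low: "parity v r s = 0" if r: "r \<in> {m1..<m0 + m1}" for r
  proof (cases "s = 0 \<or> r \<ge> 2 * m1")
    case True
    then show ?thesis using parity_recurrence(2,3)[OF v(1)] r by auto
  next
    case False
    then have "parity v (m1 + (r - m1)) (Suc (s - 1)) = parity v (r - m1) (s - 1)"
      using r by (intro parity_recurrence(1)[OF v(1)]) auto
    also have "\<dots> = 0" unfolding par using before[of "s - 1"] False by simp
    finally show ?thesis using r False by simp
  qed
  \<comment> \<open>A check of \<open>H\<^sub>1\<close> at the highest time \<open>N\<close>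
    reappears at the coefficient \<open>N + 1\<close>, which is \<open>0\<close>.\<close>
  have par_high: "parity v r N = 0" if r: "r < m1" for r
    using parity_recurrence(1)[OF v(1) r, of N] after[of "Suc N"] by (simp add: par)
  \<comment> \<open>\<open>wt\<close> counts coordinate by coordinate, so the weight of one
    coefficient is rewritten as a sum over \<open>j\<close> for a termwise comparison.\<close>
  have card: "card {j. j < n \<and> c t j \<noteq> 0} = (\<Sum>j<n. if c t j \<noteq> 0 then 1 else 0)" for t
    by (simp add: sum.If_cases Int_def)
  have wt: "wt v = (\<Sum>j<n. card {t. c t j \<noteq> 0})" by (simp add: wt_def dim c_def)
  show ?thesis
  proof (cases "s = N")
    case True
    have "parity v r s = 0" if "r < m0 + m1" for r
      using par_low[of r] par_high[of r] True that by (cases "r < m1") auto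
    then have "d0 + d1 \<le> card {j. j < n \<and> c s j \<noteq> 0}"
      using s by (intro both) (auto simp: par T_def)
    also have "\<dots> \<le> wt v"
      unfolding card wt
    proof (intro sum_mono)
      fix j
      show "(if c s j \<noteq> 0 then 1 else 0) \<le> card {t. c t j \<noteq> 0}"
        using fin[of j] by (auto simp: Suc_le_eq card_gt_0_iff)
    qed
    finally show ?thesis .
  next
    case False
    have "d0 \<le> card {j. j < n \<and> c s j \<noteq> 0}"
      using s par_low by (intro low) (auto simp: par T_def)
    moreover have "d1 \<le> card {j. j < n \<and> c N j \<noteq> 0}"
      using N par_high by (intro high) (auto simp: par T_def)
    moreover have "card {j. j < n \<and> c s j \<noteq> 0} + card {j. j < n \<and> c N j \<noteq> 0} \<le> wt v"
      unfolding card wt sum.distrib[symmetric]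
    proof (intro sum_mono)
      fix j
      have "card ({s, N} \<inter> {t. c t j \<noteq> 0}) \<le> card {t. c t j \<noteq> 0}"
        using fin[of j] by (intro card_mono) auto
      then show "(if c s j \<noteq> 0 then 1 else 0) + (if c N j \<noteq> 0 then 1 else 0) \<le> card {t. c t j \<noteq> 0}"
        using False by (auto split: if_splits)
    qed
    ultimately show ?thesis by linarith
  qed
qed

lemma convolutional_code_generator:
  "convolutional_code n (n - m0) m1 1 (free_distance (code_of generator)) (code_of generator)"
  unfolding convolutional_code_def
  using generator_reduced overall_constraint_length_generator memory_generator
  by (intro conjI bexI[of _ generator] refl) (simp_all add: carrier_matI)

lemma free_distance_ge:
  assumes "\<And>v. v \<in> code_of generator \<Longrightarrow> v \<noteq> 0\<^sub>v (dim_vec v) \<Longrightarrow> d \<le> wt v"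
  shows "d \<le> free_distance (code_of generator)"
proof -
  let ?S = "{wt v | v. v \<in> code_of generator \<and> v \<noteq> 0\<^sub>v (dim_vec v)}"
  \<comment> \<open>Row \<open>0\<close> has the nonzero constant part \<open>b 0\<close>, so the
    code has a nonzero word and the infimum is attained.\<close>
  define v where "v = vec n (\<lambda>j. generator $$ (0, j))"
  have "0 < n - m0" using m1_pos m0_m1_le_n by simp
  then have "(\<Sum>i<n - m0. (if i = 0 then 1 else 0) * generator $$ (i, j)) = generator $$ (0, j)" for j
    by (simp add: if_distrib[of "\<lambda>x. x * _"] cong: if_cong)
  then have "v \<in> code_of generator"
    unfolding code_of_iff dim_generator
    by (auto simp: v_def intro!: exI[of _ "\<lambda>i. if i = 0 then 1 else 0"])
  moreover have "v \<noteq> 0\<^sub>v (dim_vec v)"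
  proof
    assume v0: "v = 0\<^sub>v (dim_vec v)"
    obtain j where j: "j < n" "b 0 j \<noteq> 0" using b_nonzero[of 0] m0_m1_le_n m1_pos by auto
    have "v $ j = 0" using j by (subst v0) (simp add: v_def)
    then show False using j \<open>0 < n - m0\<close> m1_pos by (simp add: v_def generator_index)
  qed
  ultimately have "?S \<noteq> {}" by blast
  then have "Inf ?S \<in> ?S" by (rule Inf_nat_def1)
  then obtain w where "Inf ?S = wt w" "w \<in> code_of generator" "w \<noteq> 0\<^sub>v (dim_vec w)" by auto
  then show ?thesis unfolding free_distance_def using assms by simp
qed

end

section \<open>Instantiation with the BCH checks over the field with \<open>q ^ 2\<close>
  elements\<close>

theorem theorem5p2:
  fixes q n :: nat
  assumes "CARD('a::{field, finite}) = q"
    and "primepow q"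
    and "q \<ge> 4"
    and "n = q ^ 2 - 1"
  shows "\<exists>(C :: 'a poly vec set) d.
           convolutional_code n (n - 2 * q + 1) (2 * q - 3) 1 d C \<and> d \<ge> 2 * q + 1"
proof -
  have qq: "4 * q \<le> q * q" using assms(3) by (intro mult_right_mono) auto
  have n: "Suc n = q * q" using assms(3,4) qq by (simp add: power2_eq_square)
  have le_n: "4 * q - 4 \<le> n" using n qq by linarith
  \<comment> \<open>The characteristic divides \<open>q * q = n + 1\<close>, so \<open>n\<close>
    equals \<open>- 1\<close> in the closure and is nonzero there; hence there are exactly
    \<open>n\<close> roots of unity.\<close>
  have "CHAR('a alg_closure) dvd q"
    using CHAR_dvd_CARD[where ?'a = 'a] assms(1) by simp
  then have "of_nat (Suc n) = (0 :: 'a alg_closure)"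
    unfolding n of_nat_eq_0_iff_char_dvd by simp
  then have "of_nat n \<noteq> (0 :: 'a alg_closure)" by auto
  then have card: "card {y :: 'a alg_closure. y ^ n = 1} = n"
    by (rule card_roots_of_unity_alg_closed)
  have "finite {y :: 'a alg_closure. y ^ n = 1}"
    using card n qq assms(3) by (intro card_ge_0_finite) linarith
  then obtain x :: "nat \<Rightarrow> 'a alg_closure" where x: "bij_betw x {..<n} {y. y ^ n = 1}"
    using ex_bij_betw_nat_finite card by (metis lessThan_atLeast0)
  interpret quadratic_extension q n x
    using assms(1,2,4) x by unfold_locales
  obtain j where "j < n" "x j ^ q + - 1 * x j \<noteq> 0"
    using ex_x_not_root[of "- 1"] assms(3) by auto
  moreover obtain i where "i < n" "x i ^ q + 1 * x i \<noteq> 0"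
    using ex_x_not_root[of 1] assms(3) by auto
  ultimately interpret bch_code q n x "x j" "x i"
    using assms(3) by unfold_locales (auto simp: frobenius_x_twice add.commute)
  obtain h where h: "\<And>s. s < 4 * q - 4 \<Longrightarrow> h s = bch_row s"
    and "independent_rows n n h"
    using extend_independent_rows[OF independent_bch_rows le_n] by blast
  then obtain b where "\<And>r s. r < n \<Longrightarrow> s < n \<Longrightarrow> (\<Sum>j<n. h r j * b s j) = (if r = s then 1 else 0)"
    and "\<And>i j. i < n \<Longrightarrow> j < n \<Longrightarrow> (\<Sum>s<n. b s i * h s j) = (if i = j then 1 else 0)"
    using independent_rows_inverse by blast
  \<comment> \<open>\<open>H\<^sub>0\<close> has \<open>1 + 2 (q - 1)\<close> checks for the
    exponents below \<open>q\<close>, and \<open>H\<^sub>1\<close> has \<open>1 + 2 (q - 2)\<close>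
    for those from \<open>q + 1\<close> to \<open>2 q - 1\<close>. They determine the dimension
    \<open>n - (2 q - 1)\<close> and the degree \<open>2 q - 3\<close>.\<close>
  then interpret unit_memory_generator h b n "2 * q - 1" "2 * q - 3"
    using le_n assms(3) by unfold_locales auto
  have m: "2 * q - 1 + (2 * q - 3) = 4 * q - 4" using assms(3) by simp
  have "q + 1 + q \<le> free_distance (code_of generator)"
  proof (rule free_distance_ge, rule wt_ge)
    fix c :: "nat \<Rightarrow> 'a" assume c: "\<exists>j<n. c j \<noteq> 0"
    show "q + 1 \<le> card {j. j < n \<and> c j \<noteq> 0}"
      if "\<And>r. r \<in> {2 * q - 3..<2 * q - 1 + (2 * q - 3)} \<Longrightarrow> (\<Sum>j<n. h r j * c j) = 0"
      using that unfolding m by (intro bch_weight_low c) (simp flip: h)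
    show "q \<le> card {j. j < n \<and> c j \<noteq> 0}"
      if "\<And>r. r < 2 * q - 3 \<Longrightarrow> (\<Sum>j<n. h r j * c j) = 0"
      using that by (intro bch_weight_high c) (simp flip: h)
    show "q + 1 + q \<le> card {j. j < n \<and> c j \<noteq> 0}"
      if "\<And>r. r < 2 * q - 1 + (2 * q - 3) \<Longrightarrow> (\<Sum>j<n. h r j * c j) = 0"
      using that bch_weight_both[OF _ c] unfolding m by (simp flip: h)
  qed
  moreover have "n - (2 * q - 1) = n - 2 * q + 1" using n qq assms(3) by linarith
  ultimately show ?thesis
    using convolutional_code_generator
    by (intro exI[of _ "code_of generator"] exI[of _ "free_distance (code_of generator)"]) auto
qed

end
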